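(* Let $\Sigma\subseteq\{\veebar,\wedge,\vee,\mathbin{\barwedge},\mathbin{\dot\vee},\mathbin{\dot\barwedge}\}$, let $\mathbb{A}_0,\mathbb{B}_0$ be sets of $\Phi$-teams and $k_0\in\mathbb{N}$. Then S has a winning strategy in the game $\mathrm{FS}^\Sigma_{k_0}(\mathbb{A}_0,\mathbb{B}_0)$ if and only if there is a formula $\varphi\in\mathrm{PL}(\Sigma)$ with $\mathrm{wd}(\varphi)\leq k_0$ which separates $\mathbb{A}_0$ from $\mathbb{B}_0$.
   Context: A domain $\Phi$ is a finite set of propositional variables; a $\Phi$-team is a set of maps $\Phi\to\{0,1\}$. A split of $T$ is $(T_1,T_2)$ with $T_1,T_2\subseteq T$, $T_1\cup T_2=T$; strict if $T_1\cap T_2=\emptyset$; $\mathrm{Sp}(T)$ and $\mathrm{SSp}(T)$ denote the sets of splits and strict splits. $\Phi$-literals: $\top,\bot,{\sim}\top,{\sim}\bot,p,\neg p,{\sim}p,{\sim}\neg p$ ($p\in\Phi$); $\mathrm{PL}(\Sigma)$ is the set of formulas built from $\Phi$-literals using connectives in $\Sigma$. Semantics: $T\models\top$ always; $T\models\bot$ iff $T=\emptyset$; $T\models p$ iff $s(p)=1$ for all $s\in T$; $T\models\neg p$ iff $s(p)=0$ for all $s\in T$; $T\models{\sim}\ell$ iff $T\not\models\ell$; $\wedge$ conjunction; $T\models\psi\veebar\theta$ iff $T\models\psi$ or $T\models\theta$; $T\models\psi\vee\theta$ iff some $(S,U)\in\mathrm{Sp}(T)$ has $S\models\psi$ and $U\models\theta$;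 $T\models\psi\mathbin{\barwedge}\theta$ iff every $(S,U)\in\mathrm{Sp}(T)$ has $S\models\psi$ or $U\models\theta$; $\mathbin{\dot\vee}$ and $\mathbin{\dot\barwedge}$ are the same with $\mathrm{SSp}(T)$. Width: $\mathrm{wd}(\ell)=1$ for literals, $\mathrm{wd}(\psi\circ\theta)=\mathrm{wd}(\psi)+\mathrm{wd}(\theta)$. A formula $\varphi$ separates $\mathbb{A}$ from $\mathbb{B}$ if $A\models\varphi$ for all $A\in\mathbb{A}$ and $B\not\models\varphi$ for all $B\in\mathbb{B}$. The game $\mathrm{FS}^\Sigma_{k_0}(\mathbb{A}_0,\mathbb{B}_0)$ between players S and D has positions $(k,\mathbb{A},\mathbb{B})$ ($k\in\mathbb{N}$, $\mathbb{A},\mathbb{B}$ sets of $\Phi$-teams), starting at $(k_0,\mathbb{A}_0,\mathbb{B}_0)$. If $k_0=0$, D wins. In a position with $k\geq1$, S makes one of the following moves (a connective move only for connectives in $\Sigma$); in each connective move S also chooses $k_1,k_2>0$ with $k_1+k_2=k$, then D chooses $i\in\{1,2\}$ and play continues from the indicated position. $\veebar$-move: S chooses $\mathbb{A}_1,\mathbb{A}_2\subseteq\mathbb{A}$ with $\mathbb{A}_1\cup\mathbb{A}_2=\mathbb{A}$; next position $(k_i,\mathbb{A}_i,\mathbb{B})$. $\wedge$-move: S chooses $\mathbb{B}_1,\mathbb{B}_2\subseteq\mathbb{B}$ with union $\mathbb{B}$; next $(k_i,\mathbb{A},\mathbb{B}_i)$. $\vee$-move: for each $A\in\mathbb{A}$,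 S chooses a split $(A_1,A_2)\in\mathrm{Sp}(A)$, and for each $B\in\mathbb{B}$ a function $f_B:\mathrm{Sp}(B)\to\{1,2\}$; let $\mathbb{A}_i=\{A_i:A\in\mathbb{A}\}$ and $\mathbb{B}_i=\{B_i: B\in\mathbb{B},(B_1,B_2)\in\mathrm{Sp}(B),f_B(B_1,B_2)=i\}$; next $(k_i,\mathbb{A}_i,\mathbb{B}_i)$. $\mathbin{\barwedge}$-move: as the $\vee$-move with the roles of $\mathbb{A}$ and $\mathbb{B}$ swapped. $\mathbin{\dot\vee}$-move and $\mathbin{\dot\barwedge}$-move: as the $\vee$- and $\mathbin{\barwedge}$-moves but with only strict splits. Literal move: S chooses a $\Phi$-literal $\ell$; S wins if $\ell$ separates $\mathbb{A}$ from $\mathbb{B}$, otherwise D wins. *)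

theory Defs
  imports Main "HOL-Library.FuncSet"
begin

type_synonym 'p team = "('p \<Rightarrow> bool) set"

(* Maps from Phi to the two truth values are functions that are undefined outside Phi, so the
   empty domain has exactly one assignment. *)
definition teams :: "'p set \<Rightarrow> 'p team set" where
  "teams \<Phi> = Pow (\<Phi> \<rightarrow>\<^sub>E (UNIV :: bool set))"

definition Sp :: "'p team \<Rightarrow> ('p team \<times> 'p team) set" where
  "Sp T = {(T1, T2). T1 \<subseteq> T \<and> T2 \<subseteq> T \<and> T1 \<union> T2 = T}"

definition SSp :: "'p team \<Rightarrow> ('p team \<times> 'p team) set" where
  "SSp T = {(T1, T2). (T1, T2) \<in> Sp T \<and> T1 \<inter> T2 = {}}"

datatype 'p base_literal = Top | Bot | Var 'p | NegVar 'p

(* Tilde is the contradictory negation, written with a tilde in front of a literal;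
   NegVar is the dual negation of a variable. *)
datatype 'p literal = Base "'p base_literal" | Tilde "'p base_literal"

definition base_literals :: "'p set \<Rightarrow> 'p base_literal set" where
  "base_literals \<Phi> = {Top, Bot} \<union> Var ` \<Phi> \<union> NegVar ` \<Phi>"

definition literals :: "'p set \<Rightarrow> 'p literal set" where
  "literals \<Phi> = Base ` base_literals \<Phi> \<union> Tilde ` base_literals \<Phi>"

(* In LaTeX: veebar, wedge, vee, barwedge, dot vee, dot barwedge. *)
datatype connective = Bool_Or | And | Split_Or | Split_And | Strict_Or | Strict_And

datatype 'p form = Lit "'p literal" | Conn connective "'p form" "'p form"

inductive_set PL :: "'p set \<Rightarrow> connective set \<Rightarrow> 'p form set"
  for \<Phi> :: "'p set" and \<Sigma> :: "connective set" where
  "l \<in> literals \<Phi> \<Longrightarrow> Lit l \<in> PL \<Phi> \<Sigma>"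
| "c \<in> \<Sigma> \<Longrightarrow> \<psi> \<in> PL \<Phi> \<Sigma> \<Longrightarrow> \<theta> \<in> PL \<Phi> \<Sigma> \<Longrightarrow> Conn c \<psi> \<theta> \<in> PL \<Phi> \<Sigma>"

fun sat_base :: "'p team \<Rightarrow> 'p base_literal \<Rightarrow> bool" where
  "sat_base T Top \<longleftrightarrow> True"
| "sat_base T Bot \<longleftrightarrow> T = {}"
| "sat_base T (Var p) \<longleftrightarrow> (\<forall>s\<in>T. s p)"
| "sat_base T (NegVar p) \<longleftrightarrow> (\<forall>s\<in>T. \<not> s p)"

fun sat_literal :: "'p team \<Rightarrow> 'p literal \<Rightarrow> bool" where
  "sat_literal T (Base b) \<longleftrightarrow> sat_base T b"
| "sat_literal T (Tilde b) \<longleftrightarrow> \<not> sat_base T b"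

fun sat :: "'p team \<Rightarrow> 'p form \<Rightarrow> bool"  (infix "\<Turnstile>" 50) where
  "T \<Turnstile> Lit l \<longleftrightarrow> sat_literal T l"
| "T \<Turnstile> Conn And \<psi> \<theta> \<longleftrightarrow> T \<Turnstile> \<psi> \<and> T \<Turnstile> \<theta>"
| "T \<Turnstile> Conn Bool_Or \<psi> \<theta> \<longleftrightarrow> T \<Turnstile> \<psi> \<or> T \<Turnstile> \<theta>"
| "T \<Turnstile> Conn Split_Or \<psi> \<theta> \<longleftrightarrow> (\<exists>(S, U) \<in> Sp T. S \<Turnstile> \<psi> \<and> U \<Turnstile> \<theta>)"
| "T \<Turnstile> Conn Split_And \<psi> \<theta> \<longleftrightarrow> (\<forall>(S, U) \<in> Sp T. S \<Turnstile> \<psi> \<or> U \<Turnstile> \<theta>)"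
| "T \<Turnstile> Conn Strict_Or \<psi> \<theta> \<longleftrightarrow> (\<exists>(S, U) \<in> SSp T. S \<Turnstile> \<psi> \<and> U \<Turnstile> \<theta>)"
| "T \<Turnstile> Conn Strict_And \<psi> \<theta> \<longleftrightarrow> (\<forall>(S, U) \<in> SSp T. S \<Turnstile> \<psi> \<or> U \<Turnstile> \<theta>)"

fun wd :: "'p form \<Rightarrow> nat" where
  "wd (Lit l) = 1"
| "wd (Conn c \<psi> \<theta>) = wd \<psi> + wd \<theta>"

definition separates :: "'p form \<Rightarrow> 'p team set \<Rightarrow> 'p team set \<Rightarrow> bool" where
  "separates \<phi> \<A> \<B> \<longleftrightarrow> (\<forall>A\<in>\<A>. A \<Turnstile> \<phi>) \<and> (\<forall>B\<in>\<B>. \<not> B \<Turnstile> \<phi>)"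

datatype index = One | Two

fun component :: "index \<Rightarrow> 'a \<times> 'a \<Rightarrow> 'a" where
  "component One (x, y) = x"
| "component Two (x, y) = y"

type_synonym 'p position = "nat \<times> 'p team set \<times> 'p team set"

type_synonym 'p split_choice = "'p team \<Rightarrow> 'p team \<times> 'p team"

type_synonym 'p index_choice = "'p team \<Rightarrow> 'p team \<times> 'p team \<Rightarrow> index"

(* What S chooses in a connective move, apart from k1 and k2. A split_choice selects one split of
   each team on one side; an index_choice is the family of functions f_B from the splits of B
   to the indices, for the teams B on the other side. *)
datatype 'p choice =
    Bool_Or_Choice "'p team set" "'p team set"
  | And_Choice "'p team set" "'p team set"
  | Split_Or_Choice "'p split_choice" "'p index_choice"
  | Split_And_Choice "'p split_choice" "'p index_choice"
  | Strict_Or_Choice "'p split_choice" "'p index_choice"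
  | Strict_And_Choice "'p split_choice" "'p index_choice"

datatype 'p move = Literal_Move "'p literal" | Connective_Move nat nat "'p choice"

fun connective_of :: "'p choice \<Rightarrow> connective" where
  "connective_of (Bool_Or_Choice _ _) = Bool_Or"
| "connective_of (And_Choice _ _) = And"
| "connective_of (Split_Or_Choice _ _) = Split_Or"
| "connective_of (Split_And_Choice _ _) = Split_And"
| "connective_of (Strict_Or_Choice _ _) = Strict_Or"
| "connective_of (Strict_And_Choice _ _) = Strict_And"

fun admissible :: "'p team set \<Rightarrow> 'p team set \<Rightarrow> 'p choice \<Rightarrow> bool" where
  "admissible \<A> \<B> (Bool_Or_Choice \<A>1 \<A>2) \<longleftrightarrow> \<A>1 \<subseteq> \<A> \<and> \<A>2 \<subseteq> \<A> \<and> \<A>1 \<union> \<A>2 = \<A>"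
| "admissible \<A> \<B> (And_Choice \<B>1 \<B>2) \<longleftrightarrow> \<B>1 \<subseteq> \<B> \<and> \<B>2 \<subseteq> \<B> \<and> \<B>1 \<union> \<B>2 = \<B>"
| "admissible \<A> \<B> (Split_Or_Choice g f) \<longleftrightarrow> (\<forall>A\<in>\<A>. g A \<in> Sp A)"
| "admissible \<A> \<B> (Split_And_Choice g f) \<longleftrightarrow> (\<forall>B\<in>\<B>. g B \<in> Sp B)"
| "admissible \<A> \<B> (Strict_Or_Choice g f) \<longleftrightarrow> (\<forall>A\<in>\<A>. g A \<in> SSp A)"
| "admissible \<A> \<B> (Strict_And_Choice g f) \<longleftrightarrow> (\<forall>B\<in>\<B>. g B \<in> SSp B)"

definition chosen_parts :: "'p split_choice \<Rightarrow> index \<Rightarrow> 'p team set \<Rightarrow> 'p team set" where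
  "chosen_parts g i \<T> = {component i (g T) | T. T \<in> \<T>}"

definition indexed_parts ::
  "('p team \<Rightarrow> ('p team \<times> 'p team) set) \<Rightarrow> 'p index_choice \<Rightarrow> index \<Rightarrow> 'p team set \<Rightarrow> 'p team set" where
  "indexed_parts splits f i \<T> = {component i s | T s. T \<in> \<T> \<and> s \<in> splits T \<and> f T s = i}"

fun next_sets ::
  "'p team set \<Rightarrow> 'p team set \<Rightarrow> 'p choice \<Rightarrow> index \<Rightarrow> 'p team set \<times> 'p team set" where
  "next_sets \<A> \<B> (Bool_Or_Choice \<A>1 \<A>2) i = (component i (\<A>1, \<A>2), \<B>)"
| "next_sets \<A> \<B> (And_Choice \<B>1 \<B>2) i = (\<A>, component i (\<B>1, \<B>2))"
| "next_sets \<A> \<B> (Split_Or_Choice g f) i = (chosen_parts g i \<A>, indexed_parts Sp f i \<B>)"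
| "next_sets \<A> \<B> (Split_And_Choice g f) i = (indexed_parts Sp f i \<A>, chosen_parts g i \<B>)"
| "next_sets \<A> \<B> (Strict_Or_Choice g f) i = (chosen_parts g i \<A>, indexed_parts SSp f i \<B>)"
| "next_sets \<A> \<B> (Strict_And_Choice g f) i = (indexed_parts SSp f i \<A>, chosen_parts g i \<B>)"

fun legal :: "'p set \<Rightarrow> connective set \<Rightarrow> 'p position \<Rightarrow> 'p move \<Rightarrow> bool" where
  "legal \<Phi> \<Sigma> (k, \<A>, \<B>) (Literal_Move l) \<longleftrightarrow> k \<ge> 1 \<and> l \<in> literals \<Phi>"
| "legal \<Phi> \<Sigma> (k, \<A>, \<B>) (Connective_Move k1 k2 c) \<longleftrightarrow>
     k \<ge> 1 \<and> k1 > 0 \<and> k2 > 0 \<and> k1 + k2 = k \<and> connective_of c \<in> \<Sigma> \<and> admissible \<A> \<B> c"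

(* A history lists the completed rounds: the connective move made by S and the index chosen by D. *)
type_synonym 'p history = "('p move \<times> index) list"

type_synonym 'p strategy = "'p history \<Rightarrow> 'p move"

(* reached Phi Sigma strat p0 h p: in a play from p0 in which S follows strat, h is the history
   when the position p is reached. *)
inductive reached ::
  "'p set \<Rightarrow> connective set \<Rightarrow> 'p strategy \<Rightarrow> 'p position \<Rightarrow> 'p history \<Rightarrow> 'p position \<Rightarrow> bool"
  for \<Phi> :: "'p set" and \<Sigma> :: "connective set" and \<sigma> :: "'p strategy" and p0 :: "'p position" where
  "reached \<Phi> \<Sigma> \<sigma> p0 [] p0"
| "reached \<Phi> \<Sigma> \<sigma> p0 h (k, \<A>, \<B>) \<Longrightarrow> \<sigma> h = Connective_Move k1 k2 c \<Longrightarrow>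
     legal \<Phi> \<Sigma> (k, \<A>, \<B>) (\<sigma> h) \<Longrightarrow>
     reached \<Phi> \<Sigma> \<sigma> p0 (h @ [(\<sigma> h, i)]) (component i (k1, k2), next_sets \<A> \<B> c i)"

(* No play is infinite, because k strictly decreases in every connective move. Hence S wins every
   play in which S follows strat iff strat always prescribes a legal move and every literal move it
   prescribes is a winning one. No move is legal when k = 0, so that D wins in that case. *)
definition winning_strategy ::
  "'p set \<Rightarrow> connective set \<Rightarrow> 'p position \<Rightarrow> 'p strategy \<Rightarrow> bool" where
  "winning_strategy \<Phi> \<Sigma> p0 \<sigma> \<longleftrightarrow>
     (\<forall>h k \<A> \<B>. reached \<Phi> \<Sigma> \<sigma> p0 h (k, \<A>, \<B>) \<longrightarrow>
        legal \<Phi> \<Sigma> (k, \<A>, \<B>) (\<sigma> h) \<and>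
        (\<forall>l. \<sigma> h = Literal_Move l \<longrightarrow> separates (Lit l) \<A> \<B>))"

definition S_has_winning_strategy ::
  "'p set \<Rightarrow> connective set \<Rightarrow> nat \<Rightarrow> 'p team set \<Rightarrow> 'p team set \<Rightarrow> bool" where
  "S_has_winning_strategy \<Phi> \<Sigma> k0 \<A>0 \<B>0 \<longleftrightarrow> (\<exists>\<sigma>. winning_strategy \<Phi> \<Sigma> (k0, \<A>0, \<B>0) \<sigma>)"

lemma connective_move_decreases:
  assumes "legal \<Phi> \<Sigma> (k, \<A>, \<B>) (Connective_Move k1 k2 c)"
  shows "component i (k1, k2) < k"
  using assms by (cases i) auto

end

theory Submission
  imports Defs
begin

text \<open>A formula separating \<open>\<A>\<close> from \<open>\<B>\<close> is a plan for S: at each connective, S's choice can be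
  made so that the two immediate subformulas separate the two possible next positions, and
  conversely formulas separating the two next positions combine into one for the current position.
  Hence S can play by remembering only that the current position is separable within its width
  bound, and from a winning strategy the separating formula is assembled by induction on \<open>k\<close>.\<close>

text \<open>Skolemization: \<open>g\<close> collects one witnessing split per team. Several teams
  may yield the same part, which is harmless because \<open>P\<close> and \<open>Q\<close> are only
  demanded of all parts. For the disjunctive splitting connectives \<open>P\<close> and
  \<open>Q\<close> are truth of the two subformulas, for the conjunctive ones their falsity.\<close>

lemma ex_split_choice_iff:
  "(\<exists>g. (\<forall>T\<in>\<T>. g T \<in> splits T) \<and> (\<forall>X\<in>chosen_parts g One \<T>. P X) \<and> (\<forall>X\<in>chosen_parts g Two \<T>. Q X))
   \<longleftrightarrow> (\<forall>T\<in>\<T>. \<exists>(S, U)\<in>splits T. P S \<and> Q U)" (is "?L \<longleftrightarrow> ?R")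
proof
  assume ?L
  then obtain g where g: "\<forall>T\<in>\<T>. g T \<in> splits T"
    "\<forall>X\<in>chosen_parts g One \<T>. P X" "\<forall>X\<in>chosen_parts g Two \<T>. Q X" by blast
  show ?R
  proof
    fix T assume T: "T \<in> \<T>"
    obtain S U where SU: "g T = (S, U)" by fastforce
    have "component i (g T) \<in> chosen_parts g i \<T>" for i
      using T unfolding chosen_parts_def by blast
    from this[of One] this[of Two] have "P S" "Q U" using g SU by auto
    then show "\<exists>(S, U)\<in>splits T. P S \<and> Q U" using g(1) T SU by force
  qed
next
  assume ?R
  then have "\<forall>T\<in>\<T>. \<exists>s. s \<in> splits T \<and> P (component One s) \<and> Q (component Two s)"
    by fastforce
  then obtain g where "\<forall>T\<in>\<T>. g T \<in> splits T \<and> P (component One (g T)) \<and> Q (component Two (g T))"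
    by metis
  then show ?L unfolding chosen_parts_def by blast
qed

text \<open>For each split, the index chosen by \<open>f\<close> names a disjunct that holds; only
  that component enters the next position, so nothing is demanded of the other one.\<close>

lemma ex_index_choice_iff:
  "(\<exists>f. (\<forall>X\<in>indexed_parts splits f One \<T>. P X) \<and> (\<forall>X\<in>indexed_parts splits f Two \<T>. Q X))
   \<longleftrightarrow> (\<forall>T\<in>\<T>. \<forall>(S, U)\<in>splits T. P S \<or> Q U)" (is "?L \<longleftrightarrow> ?R")
proof
  assume ?L
  then obtain f where f: "\<forall>X\<in>indexed_parts splits f One \<T>. P X"
    "\<forall>X\<in>indexed_parts splits f Two \<T>. Q X" by blast
  have "P S \<or> Q U" if "T \<in> \<T>" "(S, U) \<in> splits T" for T S U
  proof -
    have "component (f T (S, U)) (S, U) \<in> indexed_parts splits f (f T (S, U)) \<T>"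
      using that unfolding indexed_parts_def by blast
    then show ?thesis using f by (cases "f T (S, U)") auto
  qed
  then show ?R by blast
next
  assume R: ?R
  \<comment> \<open>Index \<open>Two\<close> is the fallback: it is used only where \<open>P\<close>
    fails on the first part, and the disjunction then yields \<open>Q\<close> on the second.\<close>
  define f where "f = (\<lambda>(T :: 'a team) (s :: 'a team \<times> 'a team). if P (fst s) then One else Two)"
  have "\<forall>X\<in>indexed_parts splits f One \<T>. P X"
    unfolding indexed_parts_def f_def by (auto split: if_splits)
  moreover have "\<forall>X\<in>indexed_parts splits f Two \<T>. Q X"
    using R unfolding indexed_parts_def f_def by (fastforce split: if_splits)
  ultimately show ?L by blast
qed

lemma all_index_iff: "(\<forall>i. P i) \<longleftrightarrow> P One \<and> P Two"
  by (metis index.exhaust)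

text \<open>Exposes the constructor arguments, so that the equations for \<open>admissible\<close>
  and \<open>next_sets\<close> can rewrite under the quantifiers.\<close>

lemma ex_choice_iff:
  "(\<exists>ch. connective_of ch = c \<and> P ch) \<longleftrightarrow>
   (case c of
      Bool_Or \<Rightarrow> \<exists>X Y. P (Bool_Or_Choice X Y)
    | And \<Rightarrow> \<exists>X Y. P (And_Choice X Y)
    | Split_Or \<Rightarrow> \<exists>g f. P (Split_Or_Choice g f)
    | Split_And \<Rightarrow> \<exists>g f. P (Split_And_Choice g f)
    | Strict_Or \<Rightarrow> \<exists>g f. P (Strict_Or_Choice g f)
    | Strict_And \<Rightarrow> \<exists>g f. P (Strict_And_Choice g f))" (is "?L \<longleftrightarrow> ?R")
proof
  assume ?L
  then obtain ch where "connective_of ch = c" "P ch" by blast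
  then show ?R by (cases ch) auto
next
  assume ?R
  then show ?L
    by (cases c) (simp_all, (metis connective_of.simps)+)
qed

text \<open>One round of the game mirrors one truth clause. Left to right it tells S how to move;
  right to left it assembles a formula from those for the two successors.\<close>

lemma separates_Conn_iff:
  "separates (Conn c \<psi> \<theta>) \<A> \<B> \<longleftrightarrow>
   (\<exists>ch. connective_of ch = c \<and> admissible \<A> \<B> ch \<and>
      (\<forall>i. separates (component i (\<psi>, \<theta>)) (fst (next_sets \<A> \<B> ch i)) (snd (next_sets \<A> \<B> ch i))))"
proof -
  \<comment> \<open>Serves the two connectives without splits: the teams on one side are sorted by
    which of the two conditions they meet, overlaps being allowed.\<close>
  have cover: "(\<exists>X Y. X \<subseteq> \<T> \<and> Y \<subseteq> \<T> \<and> X \<union> Y = \<T> \<and> (\<forall>T\<in>X. P T) \<and> (\<forall>T\<in>Y. Q T))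
      \<longleftrightarrow> (\<forall>T\<in>\<T>. P T \<or> Q T)" for \<T> :: "'a team set" and P Q
    by (rule iffI, blast, rule exI[of _ "{T\<in>\<T>. P T}"], rule exI[of _ "{T\<in>\<T>. Q T}"], blast)
  \<comment> \<open>\<open>g\<close> and \<open>f\<close> act on opposite sides and are chosen
    independently, so their joint existence splits into the two preceding equivalences.\<close>
  have parts: "(\<exists>g f. (\<forall>T\<in>\<T>. g T \<in> splits T) \<and>
        ((\<forall>X\<in>chosen_parts g One \<T>. P X) \<and> (\<forall>X\<in>indexed_parts splits f One \<U>. P' X)) \<and>
        ((\<forall>X\<in>chosen_parts g Two \<T>. Q X) \<and> (\<forall>X\<in>indexed_parts splits f Two \<U>. Q' X)))
      \<longleftrightarrow> (\<forall>T\<in>\<T>. \<exists>(S, U)\<in>splits T. P S \<and> Q U) \<and> (\<forall>T\<in>\<U>. \<forall>(S, U)\<in>splits T. P' S \<or> Q' U)"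
    for \<T> \<U> :: "'a team set" and splits P Q P' Q'
    by (subst ex_split_choice_iff[symmetric], subst ex_index_choice_iff[symmetric]) blast
  \<comment> \<open>The same with the sides exchanged, matching the order in which
    \<open>next_sets\<close> lists them for the conjunctive splitting connectives.\<close>
  have parts': "(\<exists>g f. (\<forall>T\<in>\<T>. g T \<in> splits T) \<and>
        ((\<forall>X\<in>indexed_parts splits f One \<U>. P' X) \<and> (\<forall>X\<in>chosen_parts g One \<T>. P X)) \<and>
        ((\<forall>X\<in>indexed_parts splits f Two \<U>. Q' X) \<and> (\<forall>X\<in>chosen_parts g Two \<T>. Q X)))
      \<longleftrightarrow> (\<forall>T\<in>\<U>. \<forall>(S, U)\<in>splits T. P' S \<or> Q' U) \<and> (\<forall>T\<in>\<T>. \<exists>(S, U)\<in>splits T. P S \<and> Q U)"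
    for \<T> \<U> :: "'a team set" and splits P Q P' Q'
    by (subst ex_split_choice_iff[symmetric], subst ex_index_choice_iff[symmetric]) blast
  show ?thesis
  proof (cases c)
    case Bool_Or
    then show ?thesis
      using cover[of \<A> "\<lambda>T. T \<Turnstile> \<psi>" "\<lambda>T. T \<Turnstile> \<theta>"]
      unfolding ex_choice_iff all_index_iff separates_def by simp blast
  next
    case And
    then show ?thesis
      using cover[of \<B> "\<lambda>T. \<not> T \<Turnstile> \<psi>" "\<lambda>T. \<not> T \<Turnstile> \<theta>"]
      unfolding ex_choice_iff all_index_iff separates_def by simp blast
  next
    case Split_Or
    show ?thesis
      unfolding ex_choice_iff all_index_iff separates_def Split_Or
        connective.case admissible.simps next_sets.simps component.simps fst_conv snd_conv parts
      by auto
  next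
    case Split_And
    show ?thesis
      unfolding ex_choice_iff all_index_iff separates_def Split_And
        connective.case admissible.simps next_sets.simps component.simps fst_conv snd_conv parts'
      by (auto simp: case_prod_unfold)
  next
    case Strict_Or
    show ?thesis
      unfolding ex_choice_iff all_index_iff separates_def Strict_Or
        connective.case admissible.simps next_sets.simps component.simps fst_conv snd_conv parts
      by auto
  next
    case Strict_And
    show ?thesis
      unfolding ex_choice_iff all_index_iff separates_def Strict_And
        connective.case admissible.simps next_sets.simps component.simps fst_conv snd_conv parts'
      by (auto simp: case_prod_unfold)
  qed
qed

lemma wd_pos: "wd \<phi> > 0"
  by (induction \<phi>) auto

definition separable :: "'p set \<Rightarrow> connective set \<Rightarrow> 'p position \<Rightarrow> bool" where
  "separable \<Phi> \<Sigma> p \<longleftrightarrow> (\<exists>\<phi>\<in>PL \<Phi> \<Sigma>. wd \<phi> \<le> fst p \<and> separates \<phi> (fst (snd p)) (snd (snd p)))"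

text \<open>Lets the current position be recomputed from a history. The literal clause only makes
  the function total: a literal move ends the play, so it never occurs in the history of a reached
  position.\<close>

fun next_position :: "'p position \<Rightarrow> 'p move \<times> index \<Rightarrow> 'p position" where
  "next_position (k, \<A>, \<B>) (Connective_Move k1 k2 c, i) = (component i (k1, k2), next_sets \<A> \<B> c i)"
| "next_position p (Literal_Move l, i) = p"

definition good_move :: "'p set \<Rightarrow> connective set \<Rightarrow> 'p position \<Rightarrow> 'p move \<Rightarrow> bool" where
  "good_move \<Phi> \<Sigma> p m \<longleftrightarrow> legal \<Phi> \<Sigma> p m \<and>
     (case m of Literal_Move l \<Rightarrow> separates (Lit l) (fst (snd p)) (snd (snd p))
      | Connective_Move k1 k2 c \<Rightarrow> \<forall>i. separable \<Phi> \<Sigma> (next_position p (m, i)))"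

text \<open>The outermost constructor of a separating formula dictates the move.\<close>

lemma separable_imp_good_move:
  assumes "separable \<Phi> \<Sigma> p"
  shows "\<exists>m. good_move \<Phi> \<Sigma> p m"
proof -
  obtain k \<A> \<B> where p: "p = (k, \<A>, \<B>)" by (cases p)
  obtain \<phi> where \<phi>: "\<phi> \<in> PL \<Phi> \<Sigma>" "wd \<phi> \<le> k" "separates \<phi> \<A> \<B>"
    using assms by (auto simp: separable_def p)
  from \<phi>(1) show ?thesis
  proof cases
    case (1 l)
    then have "good_move \<Phi> \<Sigma> p (Literal_Move l)"
      using \<phi> by (simp add: good_move_def p)
    then show ?thesis ..
  next
    case (2 c \<psi> \<theta>)
    then obtain ch where ch: "connective_of ch = c" "admissible \<A> \<B> ch"
      "\<And>i. separates (component i (\<psi>, \<theta>)) (fst (next_sets \<A> \<B> ch i)) (snd (next_sets \<A> \<B> ch i))"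
      using \<phi>(3) separates_Conn_iff by metis
    \<comment> \<open>All surplus width goes to the second index, since the budgets must add up to
      exactly \<open>k\<close>; it is at least \<open>wd \<theta>\<close>, hence positive.\<close>
    let ?m = "Connective_Move (wd \<psi>) (k - wd \<psi>) ch"
    have "separable \<Phi> \<Sigma> (next_position p (?m, i))" for i
      unfolding separable_def using ch(3)[of i] 2 \<phi>(2)
      by (intro bexI[of _ "component i (\<psi>, \<theta>)"]) (cases i; simp add: p)+
    moreover have "legal \<Phi> \<Sigma> p ?m"
      using 2 ch \<phi>(2) wd_pos[of \<psi>] wd_pos[of \<theta>] by (simp add: p)
    ultimately have "good_move \<Phi> \<Sigma> p ?m" by (simp add: good_move_def)
    then show ?thesis ..
  qed
qed

lemma separable_imp_winning_strategy:
  assumes "separable \<Phi> \<Sigma> p0"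
  shows "\<exists>\<sigma>. winning_strategy \<Phi> \<Sigma> p0 \<sigma>"
proof -
  \<comment> \<open>The choice depends on the history only through the position it leads to, and is
    arbitrary where no good move exists.\<close>
  define \<sigma> where "\<sigma> h = (SOME m. good_move \<Phi> \<Sigma> (foldl next_position p0 h) m)" for h
  have good: "good_move \<Phi> \<Sigma> (foldl next_position p0 h) (\<sigma> h)"
    if "separable \<Phi> \<Sigma> (foldl next_position p0 h)" for h
    unfolding \<sigma>_def using separable_imp_good_move[OF that] by (rule someI_ex)
  \<comment> \<open>Both claims are proved together: separability makes the move chosen by
    \<open>SOME\<close> good, and a good move keeps the next position separable.\<close>
  have inv: "foldl next_position p0 h = p \<and> separable \<Phi> \<Sigma> p" if "reached \<Phi> \<Sigma> \<sigma> p0 h p" for h p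
    using that
  proof induction
    case 1
    then show ?case using assms by simp
  next
    case (2 h k \<A> \<B> k1 k2 c i)
    then have "good_move \<Phi> \<Sigma> (k, \<A>, \<B>) (Connective_Move k1 k2 c)"
      using good[of h] by simp
    then have "separable \<Phi> \<Sigma> (next_position (k, \<A>, \<B>) (Connective_Move k1 k2 c, i))"
      by (simp add: good_move_def)
    then show ?case using 2 by simp
  qed
  have "winning_strategy \<Phi> \<Sigma> p0 \<sigma>"
    unfolding winning_strategy_def
  proof (intro allI impI)
    fix h k \<A> \<B> assume "reached \<Phi> \<Sigma> \<sigma> p0 h (k, \<A>, \<B>)"
    then have "good_move \<Phi> \<Sigma> (k, \<A>, \<B>) (\<sigma> h)" using inv good by metis
    then show "legal \<Phi> \<Sigma> (k, \<A>, \<B>) (\<sigma> h) \<and> (\<forall>l. \<sigma> h = Literal_Move l \<longrightarrow> separates (Lit l) \<A> \<B>)"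
      by (auto simp: good_move_def)
  qed
  then show ?thesis by blast
qed

text \<open>The strategy depends on histories, so the induction ranges over all positions reached
  from the fixed start instead of restarting the game. No move is legal at \<open>k = 0\<close>, so
  that case cannot arise.\<close>

lemma winning_strategy_imp_separable:
  assumes win: "winning_strategy \<Phi> \<Sigma> p0 \<sigma>"
  shows "reached \<Phi> \<Sigma> \<sigma> p0 h (k, \<A>, \<B>) \<Longrightarrow> separable \<Phi> \<Sigma> (k, \<A>, \<B>)"
proof (induction k arbitrary: h \<A> \<B> rule: less_induct)
  case (less k)
  have legal: "legal \<Phi> \<Sigma> (k, \<A>, \<B>) (\<sigma> h)"
    and lit: "\<And>l. \<sigma> h = Literal_Move l \<Longrightarrow> separates (Lit l) \<A> \<B>"
    using win less.prems unfolding winning_strategy_def by blast+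
  show ?case
  proof (cases "\<sigma> h")
    case (Literal_Move l)
    then show ?thesis
      using legal lit by (auto simp: separable_def intro!: bexI[of _ "Lit l"] PL.intros)
  next
    case (Connective_Move k1 k2 c)
    \<comment> \<open>D may answer with either index, so both successors are reached, with smaller
      budgets.\<close>
    have sep: "separable \<Phi> \<Sigma> (component i (k1, k2), next_sets \<A> \<B> c i)" for i
    proof -
      obtain \<A>' \<B>' where n: "next_sets \<A> \<B> c i = (\<A>', \<B>')" by fastforce
      have "reached \<Phi> \<Sigma> \<sigma> p0 (h @ [(\<sigma> h, i)]) (component i (k1, k2), \<A>', \<B>')"
        using reached.intros(2)[OF less.prems Connective_Move legal, of i] n by simp
      moreover have "component i (k1, k2) < k"
        using legal Connective_Move connective_move_decreases by metis
      ultimately show ?thesis using less.IH n by simp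
    qed
    obtain \<psi> where \<psi>: "\<psi> \<in> PL \<Phi> \<Sigma>" "wd \<psi> \<le> k1"
      "separates \<psi> (fst (next_sets \<A> \<B> c One)) (snd (next_sets \<A> \<B> c One))"
      using sep[of One] by (auto simp: separable_def)
    obtain \<theta> where \<theta>: "\<theta> \<in> PL \<Phi> \<Sigma>" "wd \<theta> \<le> k2"
      "separates \<theta> (fst (next_sets \<A> \<B> c Two)) (snd (next_sets \<A> \<B> c Two))"
      using sep[of Two] by (auto simp: separable_def)
    have c: "connective_of c \<in> \<Sigma>" "admissible \<A> \<B> c" "k1 + k2 = k"
      using legal Connective_Move by auto
    have "\<forall>i. separates (component i (\<psi>, \<theta>)) (fst (next_sets \<A> \<B> c i)) (snd (next_sets \<A> \<B> c i))"
      using \<psi>(3) \<theta>(3) by (simp add: all_index_iff)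
    then have "separates (Conn (connective_of c) \<psi> \<theta>) \<A> \<B>"
      unfolding separates_Conn_iff using c(2) by blast
    moreover have "Conn (connective_of c) \<psi> \<theta> \<in> PL \<Phi> \<Sigma>"
      using c(1) \<psi>(1) \<theta>(1) by (rule PL.intros(2))
    moreover have "wd (Conn (connective_of c) \<psi> \<theta>) \<le> k"
      using \<psi>(2) \<theta>(2) c(3) by simp
    ultimately show ?thesis unfolding separable_def fst_conv snd_conv by blast
  qed
qed

theorem theorem3p2:
  fixes \<Phi> :: "'p set" and \<Sigma> :: "connective set"
    and \<A>0 \<B>0 :: "'p team set" and k0 :: nat
  assumes "finite \<Phi>" and "\<A>0 \<subseteq> teams \<Phi>" and "\<B>0 \<subseteq> teams \<Phi>"
  shows "S_has_winning_strategy \<Phi> \<Sigma> k0 \<A>0 \<B>0 \<longleftrightarrow>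
         (\<exists>\<phi> \<in> PL \<Phi> \<Sigma>. wd \<phi> \<le> k0 \<and> separates \<phi> \<A>0 \<B>0)"
proof -
  have "S_has_winning_strategy \<Phi> \<Sigma> k0 \<A>0 \<B>0 \<longleftrightarrow> separable \<Phi> \<Sigma> (k0, \<A>0, \<B>0)"
    unfolding S_has_winning_strategy_def
    using separable_imp_winning_strategy winning_strategy_imp_separable reached.intros(1) by metis
  then show ?thesis by (simp add: separable_def)
qed

end
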